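(* Let $(I,\tilde g,V,\lambda,\mu)$ be an almost $\eta$-Ricci soliton with $\eta=dx^3$ and $V=\sum_{k=1}^3V^kE_k$. Suppose that $f_1,f_2$ depend only on $x^2$ and that $V^1,V^2,V^3$ depend only on $x^3$. Then there are $c_1,c_2\in\mathbb R$, a smooth function $G=G(x^3)$ on $I_3$, and a function $F=F(x^3)$ on $I_3$ with $F'=G$, such that $$V^1=c_1,\quad V^2=c_2,\quad V^3=F,\quad c_1f_1'=0=c_2f_1',$$ $$\lambda=2f_2^2\left(\frac{f_1'}{f_1}\right)^2-f_2f_2'\frac{f_1'}{f_1}-f_2^2\frac{f_1''}{f_1},\qquad \mu(x^2,x^3)=-\lambda(x^2)-G(x^3).$$ Moreover: (i) If $J_2\subseteq I_2$ is a nontrivial interval on which $f_1$ is constant, then $\lambda(x^2)=0$ and $F'(x^3)=-\mu(x^2,x^3)$ for all $x^2\in J_2$, $x^3\in I_3$. (ii) If $f_1$ is constant, then $\lambda=0$, $\mu=\mu(x^3)$ depends only on $x^3$, and $F'(x^3)=-\mu(x^3)$ for all $x^3\in I_3$. (iii) If $f_1$ is not constant, then $V^1=V^2=0$.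
   Context: Let $I=I_1\times I_2\times I_3\subseteq\mathbb R^3$ with $I_1,I_2,I_3\subseteq\mathbb R$ open intervals and standard coordinates $x^1,x^2,x^3$. Let $f_1,f_2$ be smooth nowhere zero functions on $I$ and endow $I$ with the Riemannian metric $\tilde g=\frac{1}{f_1^2}dx^1\otimes dx^1+\frac{1}{f_2^2}dx^2\otimes dx^2+dx^3\otimes dx^3$. Let $E_1=f_1\frac{\partial}{\partial x^1}$, $E_2=f_2\frac{\partial}{\partial x^2}$, $E_3=\frac{\partial}{\partial x^3}$ (an orthonormal frame). For a smooth vector field $V$, a $1$-form $\eta$, and smooth functions $\lambda,\mu$ on $I$ with $\mu\neq0$ (not identically zero), $(I,\tilde g,V,\lambda,\mu)$ is an almost $\eta$-Ricci soliton if $\frac12\pounds_V\tilde g+\mathrm{Ric}+\lambda\tilde g+\mu\,\eta\otimes\eta=0$ on $I$, where $\pounds_V\tilde g$ is the Lie derivative of $\tilde g$ along $V$ and $\mathrm{Ric}$ is the Ricci tensor of $\tilde g$, with $\mathrm{Ric}(Y,Z)=\sum_{k}\tilde g(R(E_k,Y)Z,E_k)$, $R(X,Y)Z=\nabla_X\nabla_YZ-\nabla_Y\nabla_XZ-\nabla_{[X,Y]}Z$, $\nabla$ the Levi-Civita connection. Writing only some variables as arguments of a function means that it depends only on those variables; a prime denotes the derivative of a function of a single variable with respect to that variable. *)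

theory Defs
  imports "HOL-Analysis.Analysis"
begin

section \<open>Smooth functions on open sets\<close>

text \<open>
  All notions below are meant for an open set \<open>S\<close> in a finite-dimensional space; functions,
  vector fields and tensor fields on \<open>S\<close> are total functions whose values outside \<open>S\<close> are
  irrelevant.
\<close>

primrec Ck_on :: "nat \<Rightarrow> 'a::real_normed_vector set \<Rightarrow> ('a \<Rightarrow> 'b::real_normed_vector) \<Rightarrow> bool" where
  "Ck_on 0 S f \<longleftrightarrow> continuous_on S f"
| "Ck_on (Suc k) S f \<longleftrightarrow> (\<forall>x\<in>S. f differentiable at x) \<and>
     (\<forall>v. Ck_on k S (\<lambda>x. frechet_derivative f (at x) v))"

definition smooth_on :: "'a::real_normed_vector set \<Rightarrow> ('a \<Rightarrow> 'b::real_normed_vector) \<Rightarrow> bool" where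
  "smooth_on S f \<longleftrightarrow> (\<forall>k. Ck_on k S f)"

section \<open>Vector fields, Lie derivative, Levi-Civita connection, curvature\<close>

type_synonym 'a vec_field = "'a \<Rightarrow> 'a"
type_synonym 'a one_form = "'a \<Rightarrow> 'a \<Rightarrow> real"
type_synonym 'a tensor2 = "'a \<Rightarrow> 'a \<Rightarrow> 'a \<Rightarrow> real"
type_synonym 'a connection = "'a vec_field \<Rightarrow> 'a vec_field \<Rightarrow> 'a vec_field"

definition dir_deriv :: "'a::real_normed_vector vec_field \<Rightarrow> ('a \<Rightarrow> real) \<Rightarrow> 'a \<Rightarrow> real" where
  "dir_deriv X h x = frechet_derivative h (at x) (X x)"

definition lie_bracket :: "'a::real_normed_vector vec_field \<Rightarrow> 'a vec_field \<Rightarrow> 'a vec_field" where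
  "lie_bracket X Y x = frechet_derivative Y (at x) (X x) - frechet_derivative X (at x) (Y x)"

definition lie_deriv2 ::
  "'a::real_normed_vector vec_field \<Rightarrow> 'a tensor2 \<Rightarrow> 'a vec_field \<Rightarrow> 'a vec_field \<Rightarrow> 'a \<Rightarrow> real" where
  "lie_deriv2 V g Y Z x = dir_deriv V (\<lambda>y. g y (Y y) (Z y)) x
     - g x (lie_bracket V Y x) (Z x) - g x (Y x) (lie_bracket V Z x)"

definition smooth_one_form :: "'a::real_normed_vector set \<Rightarrow> 'a one_form \<Rightarrow> bool" where
  "smooth_one_form S \<eta> \<longleftrightarrow> (\<forall>x\<in>S. linear (\<eta> x)) \<and> (\<forall>v. smooth_on S (\<lambda>x. \<eta> x v))"

definition affine_connection :: "'a::real_normed_vector set \<Rightarrow> 'a connection \<Rightarrow> bool" where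
  "affine_connection S nabla \<longleftrightarrow>
     (\<forall>X Y. smooth_on S X \<and> smooth_on S Y \<longrightarrow> smooth_on S (nabla X Y)) \<and>
     (\<forall>X X' Y. smooth_on S X \<and> smooth_on S X' \<and> smooth_on S Y \<longrightarrow>
        (\<forall>x\<in>S. nabla (\<lambda>y. X y + X' y) Y x = nabla X Y x + nabla X' Y x)) \<and>
     (\<forall>h X Y. smooth_on S h \<and> smooth_on S X \<and> smooth_on S Y \<longrightarrow>
        (\<forall>x\<in>S. nabla (\<lambda>y. h y *\<^sub>R X y) Y x = h x *\<^sub>R nabla X Y x)) \<and>
     (\<forall>X Y Y'. smooth_on S X \<and> smooth_on S Y \<and> smooth_on S Y' \<longrightarrow>
        (\<forall>x\<in>S. nabla X (\<lambda>y. Y y + Y' y) x = nabla X Y x + nabla X Y' x)) \<and>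
     (\<forall>h X Y. smooth_on S h \<and> smooth_on S X \<and> smooth_on S Y \<longrightarrow>
        (\<forall>x\<in>S. nabla X (\<lambda>y. h y *\<^sub>R Y y) x = dir_deriv X h x *\<^sub>R Y x + h x *\<^sub>R nabla X Y x))"

definition levi_civita :: "'a::real_normed_vector set \<Rightarrow> 'a tensor2 \<Rightarrow> 'a connection \<Rightarrow> bool" where
  "levi_civita S g nabla \<longleftrightarrow> affine_connection S nabla \<and>
     (\<forall>X Y. smooth_on S X \<and> smooth_on S Y \<longrightarrow>
        (\<forall>x\<in>S. nabla X Y x - nabla Y X x = lie_bracket X Y x)) \<and>
     (\<forall>X Y Z. smooth_on S X \<and> smooth_on S Y \<and> smooth_on S Z \<longrightarrow>
        (\<forall>x\<in>S. dir_deriv X (\<lambda>y. g y (Y y) (Z y)) x = g x (nabla X Y x) (Z x) + g x (Y x) (nabla X Z x)))"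

definition curvature ::
  "'a::real_normed_vector connection \<Rightarrow> 'a vec_field \<Rightarrow> 'a vec_field \<Rightarrow> 'a vec_field \<Rightarrow> 'a vec_field" where
  "curvature nabla X Y Z x =
     nabla X (nabla Y Z) x - nabla Y (nabla X Z) x - nabla (lie_bracket X Y) Z x"

text \<open>The family \<open>E\<close> is required to be a \<open>g\<close>-orthonormal frame.\<close>

definition ricci ::
  "'a::real_normed_vector tensor2 \<Rightarrow> 'a connection \<Rightarrow> ('n::finite \<Rightarrow> 'a vec_field) \<Rightarrow>
     'a vec_field \<Rightarrow> 'a vec_field \<Rightarrow> 'a \<Rightarrow> real" where
  "ricci g nabla E Y Z x = (\<Sum>k\<in>UNIV. g x (curvature nabla (E k) Y Z x) (E k x))"

section \<open>The metric, its frame, and almost \<open>\<eta>\<close>-Ricci solitons\<close>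

definition open_interval :: "real set \<Rightarrow> bool" where
  "open_interval J \<longleftrightarrow> open J \<and> is_interval J \<and> J \<noteq> {}"

definition prod3 :: "real set \<Rightarrow> real set \<Rightarrow> real set \<Rightarrow> (real^3) set" where
  "prod3 I1 I2 I3 = {x. x $ 1 \<in> I1 \<and> x $ 2 \<in> I2 \<and> x $ 3 \<in> I3}"

definition dx :: "'n::finite \<Rightarrow> (real^'n) one_form" where
  "dx i x v = v $ i"

definition metric :: "(real^3 \<Rightarrow> real) \<Rightarrow> (real^3 \<Rightarrow> real) \<Rightarrow> (real^3) tensor2" where
  "metric f1 f2 x v w = 1 / (f1 x)\<^sup>2 * (dx 1 x v * dx 1 x w)
     + 1 / (f2 x)\<^sup>2 * (dx 2 x v * dx 2 x w) + dx 3 x v * dx 3 x w"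

text \<open>Coordinate vector fields are the constant fields \<open>axis k 1\<close>.\<close>

definition frame :: "(real^3 \<Rightarrow> real) \<Rightarrow> (real^3 \<Rightarrow> real) \<Rightarrow> 3 \<Rightarrow> (real^3) vec_field" where
  "frame f1 f2 k x =
     (if k = 1 then f1 x *\<^sub>R axis 1 1 else if k = 2 then f2 x *\<^sub>R axis 2 1 else axis 3 1)"

text \<open>
  The connection is existentially quantified because only its values on \<open>S\<close> are determined;
  on smooth fields over \<open>S\<close> it exists and is unique by the fundamental theorem of Riemannian
  geometry. The soliton equation, an identity of (0,2)-tensor fields, is stated on all pairs of
  smooth vector fields.
\<close>

definition almost_eta_ricci_soliton ::
  "(real^3) set \<Rightarrow> (real^3 \<Rightarrow> real) \<Rightarrow> (real^3 \<Rightarrow> real) \<Rightarrow> (real^3) one_form \<Rightarrow>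
     (real^3) vec_field \<Rightarrow> (real^3 \<Rightarrow> real) \<Rightarrow> (real^3 \<Rightarrow> real) \<Rightarrow> bool" where
  "almost_eta_ricci_soliton S f1 f2 \<eta> V lam mu \<longleftrightarrow>
     smooth_one_form S \<eta> \<and> smooth_on S V \<and> smooth_on S lam \<and> smooth_on S mu \<and>
     (\<exists>x\<in>S. mu x \<noteq> 0) \<and>
     (\<exists>nabla. levi_civita S (metric f1 f2) nabla \<and>
       (\<forall>Y Z. smooth_on S Y \<and> smooth_on S Z \<longrightarrow>
         (\<forall>x\<in>S. 1/2 * lie_deriv2 V (metric f1 f2) Y Z x
            + ricci (metric f1 f2) nabla (frame f1 f2) Y Z x
            + lam x * metric f1 f2 x (Y x) (Z x)
            + mu x * (\<eta> x (Y x) * \<eta> x (Z x)) = 0)))"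

end

theory Submission
  imports Defs
begin

text \<open>
  Since \<open>f\<^sub>1\<close> and \<open>f\<^sub>2\<close> depend only on \<open>x\<^sup>2\<close>, the only nonzero bracket of the frame is
  \<open>[E\<^sub>1, E\<^sub>2] = - a E\<^sub>1\<close> with \<open>a = f\<^sub>2 f\<^sub>1' / f\<^sub>1\<close>. The Koszul formula then gives the connection, and
  \<open>Ric\<close> is \<open>K = f\<^sub>2 a' - a\<^sup>2\<close> times the metric on the span of \<open>E\<^sub>1\<close>, \<open>E\<^sub>2\<close> and vanishes on \<open>E\<^sub>3\<close>. In
  the frame the soliton equation reads \<open>\<lambda> + K = 0\<close>, \<open>a V\<^sup>1 = a V\<^sup>2 = 0\<close>, \<open>(V\<^sup>1)' = (V\<^sup>2)' = 0\<close> and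
  \<open>(V\<^sup>3)' + \<lambda> + \<mu> = 0\<close>, from which everything follows with \<open>F = V\<^sup>3\<close>.
\<close>

section \<open>Calculus of smooth functions\<close>

text \<open>Fields are total functions with arbitrary values off \<open>S\<close>. Openness makes
  Frechet derivatives at points of \<open>S\<close> agree too, so the induction can pass to
  them.\<close>

lemma Ck_on_cong:
  assumes "open S" "\<And>x. x \<in> S \<Longrightarrow> f x = g x" "Ck_on k S f"
  shows "Ck_on k S g"
  using assms(2,3)
proof (induction k arbitrary: f g)
  case 0
  then show ?case by (simp cong: continuous_on_cong)
next
  case (Suc k)
  have diff: "f differentiable at x" if "x \<in> S" for x
    using Suc.prems(2) that by simp
  have "g differentiable at x" if "x \<in> S" for x
    using diff[OF that] assms(1) Suc.prems(1) that
    by (meson differentiable_def has_derivative_transform_within_open)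
  moreover have "frechet_derivative f (at x) = frechet_derivative g (at x)" if "x \<in> S" for x
    using frechet_derivative_transform_within_open[OF diff[OF that] assms(1) that] Suc.prems(1) by blast
  then have "Ck_on k S (\<lambda>x. frechet_derivative g (at x) v)" for v
    using Suc.IH[of "\<lambda>x. frechet_derivative f (at x) v" "\<lambda>x. frechet_derivative g (at x) v"]
      Suc.prems(2) by simp
  ultimately show ?case by simp
qed

text \<open>Any explicit derivative may stand in for the one chosen by
  \<open>frechet_derivative\<close>; the closure properties below rest on this.\<close>

lemma Ck_on_SucI:
  assumes "open S" "\<And>x. x \<in> S \<Longrightarrow> (f has_derivative f' x) (at x)"
    and "\<And>v. Ck_on k S (\<lambda>x. f' x v)"
  shows "Ck_on (Suc k) S f"
proof -
  have "Ck_on k S (\<lambda>x. frechet_derivative f (at x) v)" for v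
  proof (rule Ck_on_cong[OF assms(1) _ assms(3)])
    show "f' x v = frechet_derivative f (at x) v" if "x \<in> S" for x
      using frechet_derivative_at[OF assms(2)[OF that]] by simp
  qed
  then show ?thesis
    using assms(2) by (auto simp: differentiable_def)
qed

lemma Ck_on_SucD: "Ck_on (Suc k) S f \<Longrightarrow> Ck_on k S f"
proof (induction k arbitrary: f)
  case 0
  then show ?case
    by (auto intro!: continuous_at_imp_continuous_on differentiable_imp_continuous_within)
qed auto

lemma Ck_on_Suc_has_derivative:
  "Ck_on (Suc k) S f \<Longrightarrow> x \<in> S \<Longrightarrow> (f has_derivative frechet_derivative f (at x)) (at x)"
  by (simp add: frechet_derivative_works)

lemma Ck_on_const: "open S \<Longrightarrow> Ck_on k S (\<lambda>x. c)"
proof (induction k arbitrary: c)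
  case (Suc k)
  then show ?case by (intro Ck_on_SucI[where f' = "\<lambda>_ _. 0"]) auto
qed simp

lemma Ck_on_add:
  assumes "open S" "Ck_on k S f" "Ck_on k S g"
  shows "Ck_on k S (\<lambda>x. f x + g x)"
  using assms(2,3)
proof (induction k arbitrary: f g)
  case 0
  then show ?case by (auto intro: continuous_on_add)
next
  case (Suc k)
  show ?case
  proof (rule Ck_on_SucI[OF assms(1)])
    show "((\<lambda>x. f x + g x) has_derivative
        (\<lambda>v. frechet_derivative f (at x) v + frechet_derivative g (at x) v)) (at x)" if "x \<in> S" for x
      using has_derivative_add[OF Suc.prems[THEN Ck_on_Suc_has_derivative, OF that]] .
  qed (use Suc in auto)
qed

text \<open>One product rule serves both \<open>scaleR\<close> and real multiplication. Each summand
  of the derivative is again \<open>p\<close> applied to one original function and one derivative,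
  so the induction runs over arbitrary \<open>f\<close> and \<open>g\<close>.\<close>

lemma Ck_on_bounded_bilinear:
  assumes "bounded_bilinear p" "open S" "Ck_on k S f" "Ck_on k S g"
  shows "Ck_on k S (\<lambda>x. p (f x) (g x))"
  using assms(3,4)
proof (induction k arbitrary: f g)
  case 0
  then show ?case using bounded_bilinear.continuous_on[OF assms(1)] by auto
next
  case (Suc k)
  show ?case
  proof (rule Ck_on_SucI[OF assms(2)])
    show "((\<lambda>x. p (f x) (g x)) has_derivative
        (\<lambda>v. p (f x) (frechet_derivative g (at x) v) + p (frechet_derivative f (at x) v) (g x))) (at x)"
      if "x \<in> S" for x
      using bounded_bilinear.FDERIV[OF assms(1) Suc.prems[THEN Ck_on_Suc_has_derivative, OF that]] .
    show "Ck_on k S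
        (\<lambda>x. p (f x) (frechet_derivative g (at x) v) + p (frechet_derivative f (at x) v) (g x))" for v
      using Suc.prems Suc.prems[THEN Ck_on_SucD] by (intro Ck_on_add assms(2) Suc.IH) auto
  qed
qed

text \<open>The derivative in direction \<open>v\<close> is the derivative of \<open>f\<close> in
  the fixed direction \<open>L v\<close>, composed with the same affine map, so the induction
  hypothesis applies directly. Affine maps suffice here: they cover coordinate projections and
  lines.\<close>

lemma Ck_on_compose_affine:
  assumes L: "bounded_linear L" and "open T" "\<And>x. x \<in> T \<Longrightarrow> p + L x \<in> S" "Ck_on k S f"
  shows "Ck_on k T (\<lambda>x. f (p + L x))"
  using assms(4)
proof (induction k arbitrary: f)
  case 0
  have "continuous_on T (\<lambda>x. p + L x)"
    by (intro continuous_intros linear_continuous_on L)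
  with 0 assms(3) show ?case
    using continuous_on_compose2[of S f T "\<lambda>x. p + L x"] by auto
next
  case (Suc k)
  show ?case
  proof (rule Ck_on_SucI[OF assms(2)])
    fix x assume "x \<in> T"
    have "((\<lambda>x. p + L x) has_derivative L) (at x)"
      using bounded_linear_imp_has_derivative[OF L] by (auto intro!: derivative_eq_intros)
    from has_derivative_compose[OF this Ck_on_Suc_has_derivative[OF Suc.prems assms(3)[OF \<open>x \<in> T\<close>]]]
    show "((\<lambda>x. f (p + L x)) has_derivative (\<lambda>v. frechet_derivative f (at (p + L x)) (L v))) (at x)" .
  qed (use Suc in auto)
qed

lemma smooth_on_cong: "open S \<Longrightarrow> (\<And>x. x \<in> S \<Longrightarrow> f x = g x) \<Longrightarrow> smooth_on S f \<Longrightarrow> smooth_on S g"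
  unfolding smooth_on_def by (rule allI, rule Ck_on_cong[where f = f]) simp_all

lemma smooth_on_const: "open S \<Longrightarrow> smooth_on S (\<lambda>x. c)"
  by (simp add: smooth_on_def Ck_on_const)

lemma smooth_on_bounded_bilinear:
  "bounded_bilinear p \<Longrightarrow> open S \<Longrightarrow> smooth_on S f \<Longrightarrow> smooth_on S g \<Longrightarrow> smooth_on S (\<lambda>x. p (f x) (g x))"
  unfolding smooth_on_def by (rule allI, rule Ck_on_bounded_bilinear[where p = p and f = f and g = g]) simp_all

lemmas smooth_on_scaleR = smooth_on_bounded_bilinear[OF bounded_bilinear_scaleR]
lemmas smooth_on_mult = smooth_on_bounded_bilinear[OF bounded_bilinear_mult]

lemma smooth_on_minus:
  fixes f :: "'a::real_normed_vector \<Rightarrow> 'b::real_normed_vector"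
  shows "open S \<Longrightarrow> smooth_on S f \<Longrightarrow> smooth_on S (\<lambda>x. - f x)"
  using smooth_on_scaleR[of S "\<lambda>_. - 1" f] by (simp add: smooth_on_const)

lemma smooth_on_compose_affine:
  "bounded_linear L \<Longrightarrow> open T \<Longrightarrow> (\<And>x. x \<in> T \<Longrightarrow> p + L x \<in> S) \<Longrightarrow> smooth_on S f \<Longrightarrow>
    smooth_on T (\<lambda>x. f (p + L x))"
  unfolding smooth_on_def by (rule allI, rule Ck_on_compose_affine[where S = S and f = f and L = L]) simp_all

lemma smooth_on_inverse:
  fixes f :: "'a::real_normed_vector \<Rightarrow> real"
  assumes "open S" "smooth_on S f" "\<And>x. x \<in> S \<Longrightarrow> f x \<noteq> 0"
  shows "smooth_on S (\<lambda>x. inverse (f x))"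
proof -
  have "Ck_on k S (\<lambda>x. inverse (f x))" for k
  proof (induction k)
    case 0
    have "Ck_on 0 S f"
      using assms(2) unfolding smooth_on_def ..
    with assms(3) show ?case by (simp add: continuous_on_inverse)
  next
    case (Suc k)
    have f: "Ck_on (Suc k) S f" for k using assms(2) by (auto simp: smooth_on_def)
    show ?case
    proof (rule Ck_on_SucI[OF assms(1)])
      \<comment> \<open>The derivative of \<open>1/f\<close> is a product of \<open>1/f\<close>,
        \<open>f'\<close> and \<open>1/f\<close>, so \<open>1/f\<close> being of class
        \<open>k\<close> lifts to class \<open>k + 1\<close>.\<close>
      show "((\<lambda>x. inverse (f x)) has_derivative
          (\<lambda>v. (- 1) * (inverse (f x) * frechet_derivative f (at x) v * inverse (f x)))) (at x)"
        if "x \<in> S" for x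
        using Deriv.has_derivative_inverse[OF assms(3)[OF that] Ck_on_Suc_has_derivative[OF f that]] by simp
      show "Ck_on k S (\<lambda>x. (- 1) * (inverse (f x) * frechet_derivative f (at x) v * inverse (f x)))" for v
        using f[of k] Suc
        by (intro Ck_on_bounded_bilinear[OF bounded_bilinear_mult] Ck_on_const assms(1)) simp_all
    qed
  qed
  then show ?thesis by (simp add: smooth_on_def)
qed

lemma smooth_on_divide:
  fixes f g :: "'a::real_normed_vector \<Rightarrow> real"
  shows "open S \<Longrightarrow> smooth_on S f \<Longrightarrow> smooth_on S g \<Longrightarrow> (\<And>x. x \<in> S \<Longrightarrow> g x \<noteq> 0) \<Longrightarrow>
    smooth_on S (\<lambda>x. f x / g x)"
  by (simp add: divide_inverse smooth_on_mult smooth_on_inverse)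

lemma smooth_on_bounded_linear:
  assumes h: "bounded_linear h" and "open S" "smooth_on S f"
  shows "smooth_on S (\<lambda>x. h (f x))"
proof -
  have "Ck_on k S f \<Longrightarrow> Ck_on k S (\<lambda>x. h (f x))" for k
  proof (induction k arbitrary: f)
    case 0
    then show ?case using bounded_linear.continuous_on[OF h] by auto
  next
    case (Suc k)
    show ?case
    proof (rule Ck_on_SucI[OF assms(2)])
      show "((\<lambda>x. h (f x)) has_derivative (\<lambda>v. h (frechet_derivative f (at x) v))) (at x)"
        if "x \<in> S" for x
        using bounded_linear.has_derivative[OF h Ck_on_Suc_has_derivative[OF Suc.prems that]] .
    qed (use Suc in auto)
  qed
  with assms(3) show ?thesis by (simp add: smooth_on_def)
qed

lemma smooth_on_has_real_derivative:
  fixes f :: "real \<Rightarrow> real"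
  assumes "smooth_on S f" "t \<in> S"
  shows "(f has_real_derivative deriv f t) (at t)"
proof -
  have "Ck_on (Suc 0) S f"
    using assms(1) by (simp add: smooth_on_def)
  then have "f differentiable at t"
    using assms(2) by simp
  then show ?thesis
    using DERIV_deriv_iff_real_differentiable by blast
qed

lemma smooth_on_deriv:
  fixes f :: "real \<Rightarrow> real"
  assumes "open S" "smooth_on S f"
  shows "smooth_on S (deriv f)"
proof -
  have "frechet_derivative f (at t) 1 = deriv f t" if "t \<in> S" for t
    using frechet_derivative_at[OF smooth_on_has_real_derivative[OF assms(2) that, unfolded has_field_derivative_def]]
    by (metis mult.right_neutral)
  moreover have "smooth_on S (\<lambda>t. frechet_derivative f (at t) 1)"
    unfolding smooth_on_def
  proof
    show "Ck_on k S (\<lambda>t. frechet_derivative f (at t) 1)" for k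
      using assms(2) unfolding smooth_on_def by (metis Ck_on.simps(2))
  qed
  ultimately show ?thesis
    using smooth_on_cong[OF assms(1), of "\<lambda>t. frechet_derivative f (at t) 1" "deriv f"] by simp
qed

section \<open>Locality of affine connections\<close>

lemma affine_connection_zero:
  assumes "affine_connection S nabla" "open S" "smooth_on S Y" "x \<in> S"
    and X: "\<And>y. y \<in> S \<Longrightarrow> X y = 0"
  shows "nabla X Y x = 0" "nabla Y X x = 0"
proof -
  \<comment> \<open>Tensoriality: \<open>X = h X\<close> everywhere, although \<open>h\<close> vanishes on \<open>S\<close>.\<close>
  define h :: "'a \<Rightarrow> real" where "h y = (if y \<in> S then 0 else 1)" for y
  have h: "smooth_on S h"
    using smooth_on_cong[OF assms(2) _ smooth_on_const[OF assms(2)], of 0 h] by (simp add: h_def)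
  have X_smooth: "smooth_on S X"
    using smooth_on_cong[OF assms(2) _ smooth_on_const[OF assms(2)], of 0 X] X by simp
  have eq: "(\<lambda>y. h y *\<^sub>R X y) = X"
    by (auto simp: h_def X)
  have "nabla (\<lambda>y. h y *\<^sub>R X y) Y x = h x *\<^sub>R nabla X Y x"
    using assms(1,3,4) h X_smooth unfolding affine_connection_def by blast
  then show "nabla X Y x = 0"
    using \<open>x \<in> S\<close> by (simp add: eq) (simp add: h_def)
  have "nabla Y (\<lambda>y. h y *\<^sub>R X y) x = dir_deriv Y h x *\<^sub>R X x + h x *\<^sub>R nabla Y X x"
    using assms(1,3,4) h X_smooth unfolding affine_connection_def by blast
  then show "nabla Y X x = 0"
    using \<open>x \<in> S\<close> by (simp add: eq) (simp add: h_def X)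
qed

text \<open>Write \<open>X'\<close> as \<open>X + D\<close> with \<open>D\<close> vanishing on
  \<open>S\<close>; additivity reduces the claim to the previous lemma. This allows a field under
  \<open>nabla\<close> to be replaced by a frame expression that is valid only on
  \<open>S\<close>.\<close>

lemma affine_connection_cong:
  assumes conn: "affine_connection S nabla" and "open S" "smooth_on S X" "smooth_on S Y"
    and x: "x \<in> S" and eq: "\<And>y. y \<in> S \<Longrightarrow> X' y = X y"
  shows "nabla X' Y x = nabla X Y x" "nabla Y X' x = nabla Y X x"
proof -
  define D where "D = (\<lambda>y. X' y - X y)"
  have D: "D y = 0" if "y \<in> S" for y
    using that eq by (simp add: D_def)
  have D_smooth: "smooth_on S D"
    using smooth_on_cong[OF \<open>open S\<close> _ smooth_on_const[OF \<open>open S\<close>], of 0 D] D by simp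
  have X': "X' = (\<lambda>y. X y + D y)"
    by (simp add: D_def)
  have "nabla (\<lambda>y. X y + D y) Y x = nabla X Y x + nabla D Y x"
    using conn assms(3,4) x D_smooth unfolding affine_connection_def by simp
  moreover have "nabla Y (\<lambda>y. X y + D y) x = nabla Y X x + nabla Y D x"
    using conn assms(3,4) x D_smooth unfolding affine_connection_def by simp
  ultimately show "nabla X' Y x = nabla X Y x" "nabla Y X' x = nabla Y X x"
    using affine_connection_zero[OF conn \<open>open S\<close> assms(4) x D] by (simp_all add: X')
qed

section \<open>The frame and its brackets\<close>

lemma smooth_on_slice:
  assumes "open T" "smooth_on S F" "\<And>t. t \<in> T \<Longrightarrow> p + t *\<^sub>R w \<in> S"
    and "\<And>t. t \<in> T \<Longrightarrow> F (p + t *\<^sub>R w) = \<phi> t"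
  shows "smooth_on T \<phi>"
  using smooth_on_compose_affine[OF bounded_linear_scaleR_left assms(1,3,2)]
    smooth_on_cong[OF assms(1), of "\<lambda>t. F (p + t *\<^sub>R w)" \<phi>] assms(4) by simp

lemma open_prod3:
  assumes "open I1" "open I2" "open I3"
  shows "open (prod3 I1 I2 I3)"
proof -
  have "prod3 I1 I2 I3 = (\<lambda>x. x $ 1) -` I1 \<inter> (\<lambda>x. x $ 2) -` I2 \<inter> (\<lambda>x. x $ 3) -` I3"
    by (auto simp: prod3_def)
  then show ?thesis
    using assms by (auto intro!: open_Int open_vimage continuous_intros)
qed

text \<open>\<open>\<phi>1\<close> and \<open>\<phi>2\<close> are one-variable representatives of
  \<open>f1\<close> and \<open>f2\<close>. Their smoothness and nonvanishing on \<open>I2\<close>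
  are derived below from those of \<open>f1\<close> and \<open>f2\<close>.\<close>

locale warped_frame =
  fixes I1 I2 I3 :: "real set" and S :: "(real^3) set"
    and f1 f2 :: "real^3 \<Rightarrow> real" and \<phi>1 \<phi>2 :: "real \<Rightarrow> real"
  assumes I1: "open_interval I1" and I2: "open_interval I2" and I3: "open_interval I3"
    and S: "S = prod3 I1 I2 I3"
    and f1_smooth: "smooth_on S f1" and f2_smooth: "smooth_on S f2"
    and f1_nz: "x \<in> S \<Longrightarrow> f1 x \<noteq> 0" and f2_nz: "x \<in> S \<Longrightarrow> f2 x \<noteq> 0"
    and f1_eq: "x \<in> S \<Longrightarrow> f1 x = \<phi>1 (x $ 2)" and f2_eq: "x \<in> S \<Longrightarrow> f2 x = \<phi>2 (x $ 2)"
begin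

abbreviation E :: "3 \<Rightarrow> (real^3) vec_field" where "E \<equiv> frame f1 f2"
abbreviation g :: "(real^3) tensor2" where "g \<equiv> metric f1 f2"

lemma open_S: "open S"
  using I1 I2 I3 by (simp add: S open_prod3 open_interval_def)

lemma open_I2: "open I2" and open_I3: "open I3"
  using I2 I3 by (simp_all add: open_interval_def)

lemma base_point: obtains p where "p \<in> S"
proof -
  obtain a b c where "a \<in> I1" "b \<in> I2" "c \<in> I3"
    using I1 I2 I3 by (auto simp: open_interval_def)
  then have "vector [a, b, c] \<in> S"
    by (simp add: S prod3_def vector_3)
  then show ?thesis by (rule that)
qed

lemma smooth_on_I2:
  assumes "smooth_on S F" "\<And>x. x \<in> S \<Longrightarrow> F x = \<phi> (x $ 2)"
  shows "smooth_on I2 \<phi>"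
proof -
  obtain p where p: "p \<in> S" by (rule base_point)
  show ?thesis
  proof (rule smooth_on_slice[OF open_I2 assms(1)])
    \<comment> \<open>Clearing the second coordinate of \<open>p\<close> makes the line parameter
      \<open>t\<close> equal to the second coordinate itself.\<close>
    let ?q = "p - p $ 2 *\<^sub>R axis 2 1"
    show *: "?q + t *\<^sub>R axis 2 1 \<in> S" if "t \<in> I2" for t
      using p that by (simp add: S prod3_def axis_def)
    show "F (?q + t *\<^sub>R axis 2 1) = \<phi> t" if "t \<in> I2" for t
      using assms(2)[OF *[OF that]] by (simp add: axis_def)
  qed
qed

lemma smooth_on_I3:
  assumes "smooth_on S F" "\<And>x. x \<in> S \<Longrightarrow> F x = \<phi> (x $ 3)"
  shows "smooth_on I3 \<phi>"
proof -
  obtain p where p: "p \<in> S" by (rule base_point)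
  show ?thesis
  proof (rule smooth_on_slice[OF open_I3 assms(1)])
    let ?q = "p - p $ 3 *\<^sub>R axis 3 1"
    show *: "?q + t *\<^sub>R axis 3 1 \<in> S" if "t \<in> I3" for t
      using p that by (simp add: S prod3_def axis_def)
    show "F (?q + t *\<^sub>R axis 3 1) = \<phi> t" if "t \<in> I3" for t
      using assms(2)[OF *[OF that]] by (simp add: axis_def)
  qed
qed

lemma smooth_on_S: "smooth_on I2 \<phi> \<Longrightarrow> smooth_on S (\<lambda>x. \<phi> (x $ 2))"
  using smooth_on_compose_affine[OF bounded_linear_vec_nth open_S, of 0 2 I2 \<phi>]
  by (simp add: S prod3_def)

lemma phi1_smooth: "smooth_on I2 \<phi>1" and phi2_smooth: "smooth_on I2 \<phi>2"
  using smooth_on_I2 f1_smooth f1_eq f2_smooth f2_eq by blast+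

lemma point_over_I2:
  assumes "s \<in> I2" "t \<in> I3" obtains x where "x \<in> S" "x $ 2 = s" "x $ 3 = t"
proof -
  obtain p where "p \<in> S" by (rule base_point)
  with assms have "vector [p $ 1, s, t] \<in> S"
    by (simp add: S prod3_def vector_3)
  then show ?thesis by (rule that) (simp_all add: vector_3)
qed

lemma phi1_nz: "s \<in> I2 \<Longrightarrow> \<phi>1 s \<noteq> 0" and phi2_nz: "s \<in> I2 \<Longrightarrow> \<phi>2 s \<noteq> 0"
  using I3 point_over_I2 f1_nz f1_eq f2_nz f2_eq by (metis open_interval_def ex_in_conv)+

lemma coord_in: "x \<in> S \<Longrightarrow> x $ 2 \<in> I2" "x \<in> S \<Longrightarrow> x $ 3 \<in> I3"
  by (simp_all add: S prod3_def)

lemma frame_smooth: "smooth_on S (E i)"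
proof -
  consider "i = 1" | "i = 2" | "i = 3" using exhaust_3 by blast
  then show ?thesis
  proof cases
    case 1
    then show ?thesis
      using smooth_on_scaleR[OF open_S f1_smooth smooth_on_const[OF open_S]]
      by (simp add: frame_def[abs_def])
  next
    case 2
    then show ?thesis
      using smooth_on_scaleR[OF open_S f2_smooth smooth_on_const[OF open_S]]
      by (simp add: frame_def[abs_def])
  next
    case 3
    then show ?thesis
      by (simp add: frame_def[abs_def] smooth_on_const[OF open_S])
  qed
qed

lemma frame_phi:
  "x \<in> S \<Longrightarrow> E i x = (if i = 1 then \<phi>1 (x $ 2) *\<^sub>R axis 1 1
     else if i = 2 then \<phi>2 (x $ 2) *\<^sub>R axis 2 1 else axis 3 1)"
  by (simp add: frame_def f1_eq f2_eq)

lemma frame_has_derivative: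
  assumes "x \<in> S"
  shows "(E i has_derivative (\<lambda>w. (if i = 1 then w $ 2 * deriv \<phi>1 (x $ 2)
     else if i = 2 then w $ 2 * deriv \<phi>2 (x $ 2) else 0) *\<^sub>R axis i 1)) (at x)"
proof -
  let ?F = "\<lambda>x. if i = 1 then \<phi>1 (x $ 2) *\<^sub>R axis 1 1
     else if i = 2 then \<phi>2 (x $ 2) *\<^sub>R axis 2 1 else (axis 3 1 :: real^3)"
  have 2: "((\<lambda>x. x $ 2) has_derivative (\<lambda>w. w $ 2)) (at x)"
    by (rule bounded_linear_imp_has_derivative[OF bounded_linear_vec_nth])
  note d = smooth_on_has_real_derivative[OF _ coord_in(1)[OF assms]]
  note d1 = DERIV_compose_FDERIV[OF d[OF phi1_smooth] 2]
  note d2 = DERIV_compose_FDERIV[OF d[OF phi2_smooth] 2]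
  have "(?F has_derivative (\<lambda>w. (if i = 1 then w $ 2 * deriv \<phi>1 (x $ 2)
     else if i = 2 then w $ 2 * deriv \<phi>2 (x $ 2) else 0) *\<^sub>R axis i 1)) (at x)"
    using has_derivative_scaleR_left[OF d1] has_derivative_scaleR_left[OF d2]
    by (cases "i = 1"; cases "i = 2") simp_all
  then show ?thesis
    using has_derivative_transform_within_open[where f = ?F and g = "E i", OF _ open_S assms] frame_phi
    by simp
qed

definition a :: "real \<Rightarrow> real" where "a s = \<phi>2 s * deriv \<phi>1 s / \<phi>1 s"

text \<open>Every bracket of frame fields is a multiple of \<open>E 1\<close>, so a single
  coefficient for each pair records them all.\<close>

definition \<beta> :: "3 \<Rightarrow> 3 \<Rightarrow> real \<Rightarrow> real" where
  "\<beta> i j s = (if i = 1 \<and> j = 2 then - a s else if i = 2 \<and> j = 1 then a s else 0)"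

lemma a_smooth: "smooth_on I2 a"
  unfolding a_def[abs_def]
  by (intro smooth_on_divide smooth_on_mult phi1_smooth phi2_smooth smooth_on_deriv open_I2 phi1_nz)

lemma lie_bracket_frame:
  assumes "x \<in> S" shows "lie_bracket (E i) (E j) x = \<beta> i j (x $ 2) *\<^sub>R E 1 x"
proof -
  note D = frechet_derivative_at[OF frame_has_derivative[OF assms], symmetric]
  show ?thesis
    unfolding lie_bracket_def D frame_phi[OF assms] \<beta>_def a_def
    using phi1_nz[OF coord_in(1)[OF assms]] exhaust_3[of i] exhaust_3[of j]
    by (auto simp: axis_def vec_eq_iff)
qed

lemma metric_frame: "x \<in> S \<Longrightarrow> g x (E i x) (E j x) = (if i = j then 1 else 0)"
  using exhaust_3[of i] exhaust_3[of j] f1_nz[of x] f2_nz[of x]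
  by (auto simp: metric_def dx_def frame_def axis_def power2_eq_square)

lemma metric_linear:
  "g x (u + v) w = g x u w + g x v w" "g x (u - v) w = g x u w - g x v w"
  "g x (c *\<^sub>R u) w = c * g x u w" "g x 0 w = 0"
  "g x u w = g x w u"
  by (simp_all add: metric_def dx_def algebra_simps)

lemma frame_expansion:
  assumes "x \<in> S" shows "w = (\<Sum>k\<in>UNIV. g x w (E k x) *\<^sub>R E k x)"
  using f1_nz[OF assms] f2_nz[OF assms]
  by (simp add: vec_eq_iff forall_3 sum_3 metric_def dx_def frame_def axis_def power2_eq_square)

lemma dir_deriv_metric_frame:
  assumes "x \<in> S" shows "dir_deriv X (\<lambda>y. g y (E i y) (E j y)) x = 0"
proof -
  have "((\<lambda>y. g y (E i y) (E j y)) has_derivative (\<lambda>_. 0)) (at x)"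
    using has_derivative_transform_within_open[where g = "\<lambda>y. g y (E i y) (E j y)",
        OF has_derivative_const[of "if i = j then 1 else 0"] open_S assms] metric_frame by simp
  then show ?thesis
    unfolding dir_deriv_def by (simp add: frechet_derivative_at[symmetric])
qed

section \<open>Connection coefficients and Ricci curvature\<close>

text \<open>\<open>\<nabla>\<close> maps \<open>E\<^sub>j\<close> to multiples of \<open>E\<^bsub>\<kappa> j\<^esub>\<close>: \<open>\<nabla>\<^bsub>E\<^sub>1\<^esub>\<close> rotates the plane of \<open>E\<^sub>1\<close> and \<open>E\<^sub>2\<close>.\<close>

definition \<kappa> :: "3 \<Rightarrow> 3" where "\<kappa> j = (if j = 1 then 2 else if j = 2 then 1 else 3)"

definition \<gamma> :: "3 \<Rightarrow> 3 \<Rightarrow> real \<Rightarrow> real" where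
  "\<gamma> i j s = (if i = 1 \<and> j = 1 then a s else if i = 1 \<and> j = 2 then - a s else 0)"

text \<open>The frame has constant inner products, so metric compatibility is antisymmetry of
  \<open>\<Gamma>\<close> in its last two indices. With the torsion identity this determines every
  coefficient.\<close>

lemma connection_frame:
  assumes lc: "levi_civita S g nabla" and x: "x \<in> S"
  shows "nabla (E i) (E j) x = \<gamma> i j (x $ 2) *\<^sub>R E (\<kappa> j) x"
proof -
  define \<Gamma> where "\<Gamma> i j k = g x (nabla (E i) (E j) x) (E k x)" for i j k
  define B where "B i j k = \<beta> i j (x $ 2) * (if k = 1 then 1 else 0)" for i j and k :: 3
  have tor: "\<Gamma> i j k - \<Gamma> j i k = B i j k" for i j k
  proof -
    have "nabla (E i) (E j) x - nabla (E j) (E i) x = lie_bracket (E i) (E j) x"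
      using lc x frame_smooth by (simp add: levi_civita_def)
    then have "g x (nabla (E i) (E j) x - nabla (E j) (E i) x) (E k x) = B i j k"
      using metric_frame[OF x, of 1 k]
      by (simp add: lie_bracket_frame[OF x] metric_linear(3) B_def)
    then show ?thesis
      by (simp add: metric_linear(2) \<Gamma>_def)
  qed
  have met: "\<Gamma> i j k + \<Gamma> i k j = 0" for i j k
  proof -
    have "dir_deriv (E i) (\<lambda>y. g y (E j y) (E k y)) x
        = g x (nabla (E i) (E j) x) (E k x) + g x (E j x) (nabla (E i) (E k) x)"
      using lc x frame_smooth by (simp add: levi_civita_def)
    then show ?thesis
      by (simp add: dir_deriv_metric_frame[OF x] \<Gamma>_def metric_linear(5)[of x "E j x"])
  qed
  \<comment> \<open>Koszul formula: in the alternating sum of the three cyclic torsion identities,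
    antisymmetry cancels four of the six terms and makes the other two equal.\<close>
  have koszul: "2 * \<Gamma> i j k = B i j k - B j k i + B k i j" for i j k
    using tor[of i j k] tor[of j k i] tor[of k i j] met[of i j k] met[of j i k] met[of k i j] by linarith
  have "\<Gamma> i j k = \<gamma> i j (x $ 2) * (if k = \<kappa> j then 1 else 0)" for k
    using koszul[of i j k] exhaust_3[of i] exhaust_3[of j] exhaust_3[of k]
    by (auto simp: B_def \<beta>_def \<gamma>_def \<kappa>_def)
  then have "(\<Sum>k\<in>UNIV. \<Gamma> i j k *\<^sub>R E k x) = \<gamma> i j (x $ 2) *\<^sub>R E (\<kappa> j) x"
    using exhaust_3[of "\<kappa> j"] by (auto simp: sum_3)
  then show ?thesis
    using frame_expansion[OF x, of "nabla (E i) (E j) x"] by (simp add: \<Gamma>_def)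
qed

lemma gamma_smooth: "smooth_on I2 (\<gamma> i j)"
  unfolding \<gamma>_def[abs_def]
  by (cases "i = 1"; cases "j = 1"; cases "j = 2")
    (simp_all add: a_smooth smooth_on_minus smooth_on_const open_I2)

lemma beta_smooth: "smooth_on I2 (\<beta> i j)"
  unfolding \<beta>_def[abs_def]
  by (cases "i = 1"; cases "i = 2"; cases "j = 1"; cases "j = 2")
    (simp_all add: a_smooth smooth_on_minus smooth_on_const open_I2)

lemma dir_deriv_S:
  assumes "smooth_on I2 \<phi>" "x \<in> S"
  shows "dir_deriv X (\<lambda>y. \<phi> (y $ 2)) x = deriv \<phi> (x $ 2) * X x $ 2"
proof -
  have "((\<lambda>y. y $ 2) has_derivative (\<lambda>w. w $ 2)) (at x)"
    by (rule bounded_linear_imp_has_derivative[OF bounded_linear_vec_nth])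
  from DERIV_compose_FDERIV[OF smooth_on_has_real_derivative[OF assms(1) coord_in(1)[OF assms(2)]] this]
  show ?thesis
    unfolding dir_deriv_def by (simp add: frechet_derivative_at[symmetric])
qed

text \<open>Since \<open>\<kappa>\<close> is an involution, a second covariant derivative of
  \<open>E k\<close> has only components along \<open>E (\<kappa> k)\<close>, where the coefficient
  is differentiated, and along \<open>E k\<close>, where two coefficients are multiplied.\<close>

lemma curvature_frame:
  assumes lc: "levi_civita S g nabla" and x: "x \<in> S"
  shows "curvature nabla (E i) (E j) (E k) x =
    (deriv (\<gamma> j k) (x $ 2) * E i x $ 2 - deriv (\<gamma> i k) (x $ 2) * E j x $ 2
       - \<beta> i j (x $ 2) * \<gamma> 1 k (x $ 2)) *\<^sub>R E (\<kappa> k) x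
    + (\<gamma> j k (x $ 2) * \<gamma> i (\<kappa> k) (x $ 2) - \<gamma> i k (x $ 2) * \<gamma> j (\<kappa> k) (x $ 2)) *\<^sub>R E k x"
proof -
  have conn: "affine_connection S nabla"
    using lc by (simp add: levi_civita_def)
  have \<kappa>\<kappa>: "\<kappa> (\<kappa> k) = k"
    using exhaust_3[of k] by (auto simp: \<kappa>_def)
  have second: "nabla (E i) (nabla (E j) (E k)) x
      = (deriv (\<gamma> j k) (x $ 2) * E i x $ 2) *\<^sub>R E (\<kappa> k) x
        + (\<gamma> j k (x $ 2) * \<gamma> i (\<kappa> k) (x $ 2)) *\<^sub>R E k x" for i j
  proof -
    let ?c = "\<lambda>y. \<gamma> j k (y $ 2)"
    have c: "smooth_on S ?c"
      by (rule smooth_on_S[OF gamma_smooth])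
    \<comment> \<open>Locality replaces the inner derivative by its frame expression before the
      Leibniz rule is applied.\<close>
    have "nabla (E i) (nabla (E j) (E k)) x = nabla (E i) (\<lambda>y. ?c y *\<^sub>R E (\<kappa> k) y) x"
      by (rule affine_connection_cong(2)[OF conn open_S smooth_on_scaleR[OF open_S c frame_smooth]
            frame_smooth x connection_frame[OF lc]])
    also have "\<dots> = dir_deriv (E i) ?c x *\<^sub>R E (\<kappa> k) x + ?c x *\<^sub>R nabla (E i) (E (\<kappa> k)) x"
      using conn c frame_smooth x unfolding affine_connection_def by simp
    finally show ?thesis
      by (simp add: dir_deriv_S[OF gamma_smooth x] connection_frame[OF lc x] \<kappa>\<kappa>)
  qed
  let ?b = "\<lambda>y. \<beta> i j (y $ 2)"
  have b: "smooth_on S ?b"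
    by (rule smooth_on_S[OF beta_smooth])
  have "nabla (lie_bracket (E i) (E j)) (E k) x = nabla (\<lambda>y. ?b y *\<^sub>R E 1 y) (E k) x"
    by (rule affine_connection_cong(1)[OF conn open_S smooth_on_scaleR[OF open_S b frame_smooth]
          frame_smooth x lie_bracket_frame])
  also have "\<dots> = ?b x *\<^sub>R nabla (E 1) (E k) x"
    using conn b frame_smooth x unfolding affine_connection_def by simp
  finally show ?thesis
    by (simp add: curvature_def second connection_frame[OF lc x] algebra_simps)
qed

text \<open>Geometrically, the metric is the product of a surface in \<open>x^1\<close>,
  \<open>x^2\<close> and a line. The nonzero entry is the Gaussian curvature of the surface, and the
  line is flat.\<close>

lemma ricci_frame:
  assumes lc: "levi_civita S g nabla" and x: "x \<in> S"
  shows "ricci g nabla E (E j) (E k) x =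
    (if j = k \<and> j \<noteq> 3 then \<phi>2 (x $ 2) * deriv a (x $ 2) - (a (x $ 2))\<^sup>2 else 0)"
proof -
  have d_minus: "deriv (\<lambda>s. - a s) (x $ 2) = - deriv a (x $ 2)"
    using DERIV_imp_deriv[OF DERIV_minus[OF
          smooth_on_has_real_derivative[OF a_smooth coord_in(1)[OF x]]]] .
  have \<gamma>_fun: "\<gamma> 1 1 = a" "\<gamma> 1 2 = (\<lambda>s. - a s)" "\<gamma> 1 3 = (\<lambda>_. 0)" "\<gamma> 2 k = (\<lambda>_. 0)" "\<gamma> 3 k = (\<lambda>_. 0)" for k
    by (simp_all add: \<gamma>_def fun_eq_iff)
  have E2: "E i x $ 2 = (if i = 2 then \<phi>2 (x $ 2) else 0)" for i
    by (simp add: frame_phi[OF x] axis_def)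
  show ?thesis
    unfolding ricci_def curvature_frame[OF lc x] metric_linear(1,3) sum_3 E2
    using exhaust_3[of j] exhaust_3[of k]
    by (auto simp: metric_frame[OF x] \<kappa>_def \<gamma>_fun d_minus \<beta>_def power2_eq_square)
qed

section \<open>The soliton equation in the frame\<close>

text \<open>The functions \<open>g(E i, E j)\<close> are constant, so only the two bracket terms of
  the Lie derivative survive.\<close>

lemma lie_deriv_frame:
  assumes V: "smooth_on S V" "\<forall>x\<in>S. V x = (\<Sum>k\<in>UNIV. v k (x $ 3) *\<^sub>R E k x)"
    and v: "\<And>k. smooth_on I3 (v k)" and x: "x \<in> S"
  shows "lie_deriv2 V g (E i) (E j) x =
    (if j = 3 then deriv (v i) (x $ 3) else 0) + (if i = 3 then deriv (v j) (x $ 3) else 0)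
    - (if i = 1 \<and> j = 1 then 2 * a (x $ 2) * v 2 (x $ 3) else 0)
    + (if i = 1 \<and> j = 2 \<or> i = 2 \<and> j = 1 then a (x $ 2) * v 1 (x $ 3) else 0)"
proof -
  let ?D = "\<lambda>k w. (if k = 1 then w $ 2 * deriv \<phi>1 (x $ 2)
     else if k = 2 then w $ 2 * deriv \<phi>2 (x $ 2) else 0) *\<^sub>R (axis k 1 :: real^3)"
  have 3: "((\<lambda>x. x $ 3) has_derivative (\<lambda>w. w $ 3)) (at x)"
    by (rule bounded_linear_imp_has_derivative[OF bounded_linear_vec_nth])
  note dv = DERIV_compose_FDERIV[OF smooth_on_has_real_derivative[OF v coord_in(2)[OF x]] 3]
  have "((\<lambda>x. \<Sum>k\<in>UNIV. v k (x $ 3) *\<^sub>R E k x) has_derivative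
      (\<lambda>w. \<Sum>k\<in>UNIV. v k (x $ 3) *\<^sub>R ?D k w + (w $ 3 * deriv (v k) (x $ 3)) *\<^sub>R E k x)) (at x)"
    by (intro has_derivative_sum has_derivative_scaleR dv frame_has_derivative[OF x])
  then have "(V has_derivative
      (\<lambda>w. \<Sum>k\<in>UNIV. v k (x $ 3) *\<^sub>R ?D k w + (w $ 3 * deriv (v k) (x $ 3)) *\<^sub>R E k x)) (at x)"
    using has_derivative_transform_within_open[where g = V, OF _ open_S x] V(2) by simp
  note DV = frechet_derivative_at[OF this, symmetric]
  note DE = frechet_derivative_at[OF frame_has_derivative[OF x], symmetric]
  have nz: "\<phi>1 (x $ 2) \<noteq> 0" "\<phi>2 (x $ 2) \<noteq> 0"
    using phi1_nz phi2_nz coord_in(1)[OF x] by auto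
  \<comment> \<open>This is the Leibniz rule for \<open>[V, E i]\<close>: the components of
    \<open>V\<close> depend on \<open>x^3\<close> only, so \<open>E i\<close> differentiates them
    just for \<open>i = 3\<close>, and the brackets \<open>[E 2, E 1]\<close> and
    \<open>[E 1, E 2]\<close> give the terms with \<open>a\<close>.\<close>
  have bracket: "lie_bracket V (E i) x = - (if i = 3 then \<Sum>k\<in>UNIV. deriv (v k) (x $ 3) *\<^sub>R E k x else 0)
      + (if i = 1 then (a (x $ 2) * v 2 (x $ 3)) *\<^sub>R E 1 x else 0)
      - (if i = 2 then (a (x $ 2) * v 1 (x $ 3)) *\<^sub>R E 1 x else 0)" for i
    unfolding lie_bracket_def DV DE bspec[OF V(2) x] sum_3 frame_phi[OF x] a_def
    using nz exhaust_3[of i]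
    by (auto simp: axis_def vec_eq_iff forall_3)
  have g_bracket: "g x (lie_bracket V (E i) x) (E j x) = - (if i = 3 then deriv (v j) (x $ 3) else 0)
      + (if i = 1 \<and> j = 1 then a (x $ 2) * v 2 (x $ 3) else 0)
      - (if i = 2 \<and> j = 1 then a (x $ 2) * v 1 (x $ 3) else 0)" for i j
    unfolding bracket sum_3
    using exhaust_3[of i] exhaust_3[of j]
    by (auto simp: metric_frame[OF x] metric_linear(1-4) metric_linear(3)[of x "-1", simplified])
  have "lie_deriv2 V g (E i) (E j) x
      = - g x (lie_bracket V (E i) x) (E j x) - g x (lie_bracket V (E j) x) (E i x)"
    by (simp add: lie_deriv2_def dir_deriv_metric_frame[OF x] metric_linear(5)[of x "E i x" "lie_bracket V (E j) x"])
  then show ?thesis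
    using exhaust_3[of i] exhaust_3[of j] by (elim disjE) (simp_all add: g_bracket)
qed

lemma deriv_a:
  assumes "s \<in> I2"
  shows "deriv a s = deriv \<phi>2 s * deriv \<phi>1 s / \<phi>1 s + \<phi>2 s * deriv (deriv \<phi>1) s / \<phi>1 s
    - \<phi>2 s * (deriv \<phi>1 s / \<phi>1 s)\<^sup>2"
proof -
  note d = smooth_on_has_real_derivative[OF _ assms]
  have "(a has_real_derivative deriv \<phi>2 s * deriv \<phi>1 s / \<phi>1 s + \<phi>2 s * deriv (deriv \<phi>1) s / \<phi>1 s
      - \<phi>2 s * (deriv \<phi>1 s / \<phi>1 s)\<^sup>2) (at s)"
    unfolding a_def[abs_def]
    by (rule derivative_eq_intros d phi1_smooth phi2_smooth smooth_on_deriv open_I2 phi1_nz assms refl)+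
      (simp add: phi1_nz[OF assms] field_simps power2_eq_square)
  then show ?thesis by (rule DERIV_imp_deriv)
qed

text \<open>Smooth frame fields are admissible test fields, so the tensor equation may be read off
  entry by entry.\<close>

lemma soliton_components:
  assumes sol: "almost_eta_ricci_soliton S f1 f2 (dx 3) V lam mu"
    and V: "\<forall>x\<in>S. V x = (\<Sum>k\<in>UNIV. v k (x $ 3) *\<^sub>R E k x)"
    and v: "\<And>k. smooth_on I3 (v k)" and x: "x \<in> S"
  shows "lam x = (a (x $ 2))\<^sup>2 - \<phi>2 (x $ 2) * deriv a (x $ 2)"
    and "a (x $ 2) * v 1 (x $ 3) = 0" "a (x $ 2) * v 2 (x $ 3) = 0"
    and "deriv (v 1) (x $ 3) = 0" "deriv (v 2) (x $ 3) = 0"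
    and "mu x = - lam x - deriv (v 3) (x $ 3)"
proof -
  obtain nabla where lc: "levi_civita S g nabla"
    and eq: "\<And>Y Z. smooth_on S Y \<Longrightarrow> smooth_on S Z \<Longrightarrow>
      1/2 * lie_deriv2 V g Y Z x + ricci g nabla E Y Z x + lam x * g x (Y x) (Z x)
        + mu x * (dx 3 x (Y x) * dx 3 x (Z x)) = 0"
    using sol x unfolding almost_eta_ricci_soliton_def by blast
  have V_smooth: "smooth_on S V"
    using sol by (simp add: almost_eta_ricci_soliton_def)
  have eta: "dx 3 x (E i x) = (if i = 3 then 1 else 0)" for i
    using exhaust_3[of i] by (auto simp add: dx_def frame_def axis_def)
  note e = eq[OF frame_smooth frame_smooth, unfolded lie_deriv_frame[OF V_smooth V v x]
      ricci_frame[OF lc x] metric_frame[OF x] eta]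
  show lam: "lam x = (a (x $ 2))\<^sup>2 - \<phi>2 (x $ 2) * deriv a (x $ 2)"
    using e[of 2 2] by simp
  \<comment> \<open>The (1,1) and (2,2) entries differ only in the Lie derivative, so comparing them
    isolates this product.\<close>
  show "a (x $ 2) * v 2 (x $ 3) = 0"
    using e[of 1 1] lam by simp
  show "a (x $ 2) * v 1 (x $ 3) = 0"
    using e[of 1 2] by simp
  show "deriv (v 1) (x $ 3) = 0" "deriv (v 2) (x $ 3) = 0"
    using e[of 1 3] e[of 2 3] by simp_all
  show "mu x = - lam x - deriv (v 3) (x $ 3)"
    using e[of 3 3] by simp
qed

text \<open>Smoothness is known for \<open>V\<close> only. Dividing its first two coordinates by the
  nowhere zero \<open>f1\<close> and \<open>f2\<close> recovers the coefficients; the third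
  coordinate is already \<open>v 3\<close>.\<close>

lemma components_smooth:
  assumes "smooth_on S V" and V: "\<forall>x\<in>S. V x = (\<Sum>k\<in>UNIV. v k (x $ 3) *\<^sub>R E k x)"
  shows "smooth_on I3 (v k)"
proof -
  have V_nth: "smooth_on S (\<lambda>x. V x $ k)" for k
    using smooth_on_bounded_linear[OF bounded_linear_vec_nth open_S assms(1)] .
  have eq: "V x $ k = v k (x $ 3) * (if k = 1 then f1 x else if k = 2 then f2 x else 1)"
    if "x \<in> S" for x k
    using exhaust_3[of k] by (auto simp: bspec[OF V that] sum_3 frame_def axis_def)
  consider "k = 1" | "k = 2" | "k = 3" using exhaust_3 by blast
  then show ?thesis
  proof cases
    case 1
    show ?thesis
      by (rule smooth_on_I3[OF smooth_on_divide[OF open_S V_nth[of 1] f1_smooth f1_nz]])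
        (simp_all add: eq 1 f1_nz)
  next
    case 2
    show ?thesis
      by (rule smooth_on_I3[OF smooth_on_divide[OF open_S V_nth[of 2] f2_smooth f2_nz]])
        (simp_all add: eq 2 f2_nz)
  next
    case 3
    show ?thesis
      by (rule smooth_on_I3[OF V_nth[of 3]]) (simp_all add: eq 3)
  qed
qed

end

section \<open>From pointwise equations to statements on intervals\<close>

lemma constant_on_deriv_zero:
  fixes f :: "real \<Rightarrow> real"
  assumes "(f has_real_derivative D) (at s)" "s \<in> J" "s islimpt J"
    and const: "\<And>t. t \<in> J \<Longrightarrow> f t = c"
  shows "D = 0"
proof (rule vector_derivative_unique_within)
  \<comment> \<open>Working within \<open>J\<close> also covers endpoints of a non-open interval: at
    a limit point of \<open>J\<close> the derivative within \<open>J\<close> is unique.\<close>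
  show "at s within J \<noteq> bot"
    using assms(3) by (simp add: trivial_limit_within)
  show "(f has_vector_derivative D) (at s within J)"
    using has_field_derivative_at_within[OF assms(1)]
    by (simp add: has_real_derivative_iff_has_vector_derivative)
  show "(f has_vector_derivative 0) (at s within J)"
    using has_vector_derivative_transform[where g = f, OF \<open>s \<in> J\<close> _ has_vector_derivative_const[of c]] const
    by simp
qed

theorem theorem3p17:
  fixes I1 I2 I3 :: "real set" and I :: "(real^3) set"
    and f1 f2 lam mu :: "real^3 \<Rightarrow> real"
    and \<phi>1 \<phi>2 :: "real \<Rightarrow> real"
    and V :: "real^3 \<Rightarrow> real^3"
    and v :: "3 \<Rightarrow> real \<Rightarrow> real"
  assumes "open_interval I1" and "open_interval I2" and "open_interval I3"
    and "I = prod3 I1 I2 I3"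
    and "smooth_on I f1" and "smooth_on I f2"
    and "\<forall>x\<in>I. f1 x \<noteq> 0" and "\<forall>x\<in>I. f2 x \<noteq> 0"
    and "almost_eta_ricci_soliton I f1 f2 (dx 3) V lam mu"
    and "\<forall>x\<in>I. f1 x = \<phi>1 (x $ 2)" and "\<forall>x\<in>I. f2 x = \<phi>2 (x $ 2)"
    and "\<forall>x\<in>I. V x = (\<Sum>k\<in>UNIV. v k (x $ 3) *\<^sub>R frame f1 f2 k x)"
  shows "\<exists>c1 c2 :: real. \<exists>G F :: real \<Rightarrow> real.
      smooth_on I3 G \<and>
      (\<forall>t\<in>I3. (F has_real_derivative G t) (at t)) \<and>
      (\<forall>t\<in>I3. v 1 t = c1 \<and> v 2 t = c2 \<and> v 3 t = F t) \<and>
      (\<forall>s\<in>I2. c1 * deriv \<phi>1 s = 0 \<and> c2 * deriv \<phi>1 s = 0) \<and>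
      (\<forall>x\<in>I. lam x = (let s = x $ 2 in
           2 * (\<phi>2 s)\<^sup>2 * (deriv \<phi>1 s / \<phi>1 s)\<^sup>2
           - \<phi>2 s * deriv \<phi>2 s * (deriv \<phi>1 s / \<phi>1 s)
           - (\<phi>2 s)\<^sup>2 * (deriv (deriv \<phi>1) s / \<phi>1 s))) \<and>
      (\<forall>x\<in>I. mu x = - lam x - G (x $ 3)) \<and>
      (\<forall>J2. J2 \<subseteq> I2 \<and> is_interval J2 \<and> (\<exists>a\<in>J2. \<exists>b\<in>J2. a \<noteq> b) \<and> \<phi>1 constant_on J2 \<longrightarrow>
         (\<forall>x\<in>I. x $ 2 \<in> J2 \<longrightarrow> lam x = 0 \<and> deriv F (x $ 3) = - mu x)) \<and>
      (f1 constant_on I \<longrightarrow>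
         (\<forall>x\<in>I. lam x = 0) \<and>
         (\<exists>m. (\<forall>x\<in>I. mu x = m (x $ 3)) \<and> (\<forall>t\<in>I3. deriv F t = - m t))) \<and>
      (\<not> f1 constant_on I \<longrightarrow> (\<forall>t\<in>I3. v 1 t = 0 \<and> v 2 t = 0))"
proof -
  interpret warped_frame I1 I2 I3 I f1 f2 \<phi>1 \<phi>2
    using assms by unfold_locales auto
  have v: "smooth_on I3 (v k)" for k
    using components_smooth[OF _ assms(12)] assms(9) by (simp add: almost_eta_ricci_soliton_def)
  note sol = soliton_components[OF assms(9,12) v]
  note dv = smooth_on_has_real_derivative[OF v]
  have dphi: "(\<phi>1 has_real_derivative deriv \<phi>1 s) (at s)"
    "(deriv \<phi>1 has_real_derivative deriv (deriv \<phi>1) s) (at s)" if "s \<in> I2" for s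
    using smooth_on_has_real_derivative[OF _ that] phi1_smooth smooth_on_deriv[OF open_I2] by blast+
  have lam: "lam x = 2 * (\<phi>2 s)\<^sup>2 * (deriv \<phi>1 s / \<phi>1 s)\<^sup>2
      - \<phi>2 s * deriv \<phi>2 s * (deriv \<phi>1 s / \<phi>1 s) - (\<phi>2 s)\<^sup>2 * (deriv (deriv \<phi>1) s / \<phi>1 s)"
    if "x \<in> I" and s: "s = x $ 2" for x s
    \<comment> \<open>The factor 2 in the formula collects one square from \<open>a^2\<close> and
      one from the quotient rule in \<open>deriv a\<close>.\<close>
    unfolding sol(1)[OF that(1)] s deriv_a[OF coord_in(1)[OF that(1)]] a_def
    by (simp add: power2_eq_square algebra_simps)
  have I3_convex: "convex I3" and I2_convex: "convex I2"
    using I2 I3 by (simp_all add: open_interval_def is_interval_convex)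
  \<comment> \<open>The component equations live at points of \<open>I\<close>; each
    \<open>t\<close> in \<open>I3\<close> is the third coordinate of such a point.\<close>
  have v_prime: "deriv (v 1) t = 0" "deriv (v 2) t = 0" if t: "t \<in> I3" for t
  proof -
    obtain s where "s \<in> I2"
      using I2 by (auto simp: open_interval_def)
    then obtain x where "x \<in> I" "x $ 3 = t"
      using t by (rule point_over_I2)
    then show "deriv (v 1) t = 0" "deriv (v 2) t = 0"
      using sol(4,5) by auto
  qed
  obtain c1 where c1: "v 1 t = c1" if "t \<in> I3" for t
    using has_field_derivative_zero_constant[OF I3_convex, of "v 1"] v_prime(1)
      has_field_derivative_at_within[OF dv] by metis
  obtain c2 where c2: "v 2 t = c2" if "t \<in> I3" for t
    using has_field_derivative_zero_constant[OF I3_convex, of "v 2"] v_prime(2)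
      has_field_derivative_at_within[OF dv] by metis
  obtain t0 where t0: "t0 \<in> I3"
    using I3 by (auto simp: open_interval_def)
  have c_phi: "c1 * deriv \<phi>1 s = 0" "c2 * deriv \<phi>1 s = 0" if s: "s \<in> I2" for s
  proof -
    obtain x where x: "x \<in> I" "x $ 2 = s" "x $ 3 = t0"
      using s t0 by (rule point_over_I2)
    then show "c1 * deriv \<phi>1 s = 0" "c2 * deriv \<phi>1 s = 0"
      \<comment> \<open>As \<open>\<phi>1\<close> and \<open>\<phi>2\<close> do not vanish,
        \<open>a\<close> vanishes exactly where \<open>deriv \<phi>1\<close> does.\<close>
      using sol(2,3)[OF x(1)] c1[OF t0] c2[OF t0] phi1_nz[OF s] phi2_nz[OF s] by (auto simp: a_def)
  qed
  \<comment> \<open>Every term of the formula for \<open>lam\<close> contains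
    \<open>deriv \<phi>1\<close> or its derivative. Both vanish on \<open>J\<close> by two
    applications of \<open>constant_on_deriv_zero\<close>. A set without isolated points covers both
    \<open>J2\<close> and \<open>I2\<close>.\<close>
  have lam_const: "lam x = 0"
    if "x \<in> I" "x $ 2 \<in> J" "J \<subseteq> I2" "\<And>s. s \<in> J \<Longrightarrow> s islimpt J" "\<phi>1 constant_on J" for x J
  proof -
    obtain c where c: "\<And>s. s \<in> J \<Longrightarrow> \<phi>1 s = c"
      using \<open>\<phi>1 constant_on J\<close> by (auto simp: constant_on_def)
    have 1: "deriv \<phi>1 s = 0" if "s \<in> J" for s
      using constant_on_deriv_zero[OF dphi(1) \<open>s \<in> J\<close> _ c] that \<open>J \<subseteq> I2\<close> \<open>\<And>s. s \<in> J \<Longrightarrow> s islimpt J\<close> by blast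
    have "deriv (deriv \<phi>1) (x $ 2) = 0"
      using constant_on_deriv_zero[OF dphi(2) \<open>x $ 2 \<in> J\<close> _ 1] that by blast
    with 1[OF \<open>x $ 2 \<in> J\<close>] show ?thesis
      by (simp add: lam[OF \<open>x \<in> I\<close> refl])
  qed
  have F: "deriv (v 3) (x $ 3) = - mu x" if "x \<in> I" "lam x = 0" for x
    using sol(6)[OF that(1)] that(2) by simp
  have part1: "lam x = 0"
    if "J \<subseteq> I2" "is_interval J" "p \<in> J" "q \<in> J" "p \<noteq> q" "\<phi>1 constant_on J" "x \<in> I" "x $ 2 \<in> J" for J p q x
  proof (rule lam_const)
    show "s islimpt J" if "s \<in> J" for s
      using \<open>is_interval J\<close> \<open>p \<in> J\<close> \<open>q \<in> J\<close> \<open>p \<noteq> q\<close> that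
      \<comment> \<open>A connected set with two distinct points has no isolated points.\<close>
      by (intro connected_imp_perfect) (auto simp: is_interval_connected)
  qed (use that in auto)
  have part2: "lam x = 0" if const: "f1 constant_on I" and "x \<in> I" for x
  proof (rule lam_const)
    show "s islimpt I2" if "s \<in> I2" for s
      using that open_I2 by (intro interior_limit_point) (simp add: interior_open)
    show "\<phi>1 constant_on I2"
      using const t0 point_over_I2 f1_eq unfolding constant_on_def by metis
  qed (use that coord_in in auto)
  have part3: "c1 = 0 \<and> c2 = 0" if "\<not> f1 constant_on I"
  proof (rule ccontr)
    assume "\<not> (c1 = 0 \<and> c2 = 0)"
    \<comment> \<open>A nonzero \<open>c1\<close> or \<open>c2\<close> can be cancelled in
      \<open>c_phi\<close>, which forces \<open>\<phi>1\<close>, hence \<open>f1\<close>, to be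
      constant.\<close>
    then have "deriv \<phi>1 s = 0" if "s \<in> I2" for s
      using c_phi[OF that] by auto
    then have "\<exists>c. \<forall>s\<in>I2. \<phi>1 s = c"
      using has_field_derivative_zero_constant[OF I2_convex] has_field_derivative_at_within[OF dphi(1)]
      by metis
    then have "f1 constant_on I"
      using f1_eq coord_in(1) unfolding constant_on_def by metis
    with that show False by contradiction
  qed
  show ?thesis
  proof (intro exI conjI)
    \<comment> \<open>The witnesses are fixed by unification: \<open>G\<close> is
      \<open>deriv (v 3)\<close>, and the next goal makes \<open>F\<close> equal to
      \<open>v 3\<close>.\<close>
    show "smooth_on I3 (deriv (v 3))"
      by (rule smooth_on_deriv[OF open_I3 v])
    show "\<forall>t\<in>I3. (v 3 has_real_derivative deriv (v 3) t) (at t)"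
      using dv by blast
    show "\<forall>t\<in>I3. v 1 t = c1 \<and> v 2 t = c2 \<and> v 3 t = v 3 t"
      using c1 c2 by blast
    show "\<forall>s\<in>I2. c1 * deriv \<phi>1 s = 0 \<and> c2 * deriv \<phi>1 s = 0"
      using c_phi by blast
    show "\<forall>x\<in>I. lam x = (let s = x $ 2 in
           2 * (\<phi>2 s)\<^sup>2 * (deriv \<phi>1 s / \<phi>1 s)\<^sup>2
           - \<phi>2 s * deriv \<phi>2 s * (deriv \<phi>1 s / \<phi>1 s)
           - (\<phi>2 s)\<^sup>2 * (deriv (deriv \<phi>1) s / \<phi>1 s))"
      by (simp add: Let_def lam)
    show "\<forall>x\<in>I. mu x = - lam x - deriv (v 3) (x $ 3)"
      using sol(6) by blast
    show "\<forall>J2. J2 \<subseteq> I2 \<and> is_interval J2 \<and> (\<exists>a\<in>J2. \<exists>b\<in>J2. a \<noteq> b) \<and> \<phi>1 constant_on J2 \<longrightarrow>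
         (\<forall>x\<in>I. x $ 2 \<in> J2 \<longrightarrow> lam x = 0 \<and> deriv (v 3) (x $ 3) = - mu x)"
      using part1 F by blast
    show "f1 constant_on I \<longrightarrow> (\<forall>x\<in>I. lam x = 0) \<and>
         (\<exists>m. (\<forall>x\<in>I. mu x = m (x $ 3)) \<and> (\<forall>t\<in>I3. deriv (v 3) t = - m t))"
      \<comment> \<open>With \<open>lam\<close> zero, the (3,3) equation presents \<open>mu\<close>
        as the function \<open>- deriv (v 3)\<close> of \<open>x^3\<close>.\<close>
      using part2 sol(6) by (auto intro!: exI[of _ "\<lambda>t. - deriv (v 3) t"])
    show "\<not> f1 constant_on I \<longrightarrow> (\<forall>t\<in>I3. v 1 t = 0 \<and> v 2 t = 0)"
      using part3 c1 c2 by blast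
  qed
qed

end
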